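(* For all $n\ge 1$, $sat(Q_n,Q_2)<10\cdot 2^n$.
   Context: $Q_n$ is the hypercube on $\{0,1\}^n$ with edges between vertices differing in exactly one coordinate; $Q_2$ is the 4-cycle. A graph $G$ is $(Q_n,Q_2)$-saturated if $G\subseteq Q_n$, $G$ contains no subgraph isomorphic to $Q_2$, and adding any edge of $E(Q_n)\setminus E(G)$ creates such a subgraph. $sat(Q_n,Q_2)$ is the minimum number of edges of a $(Q_n,Q_2)$-saturated graph. *)

theory Defs
  imports Main
begin

text \<open>Hypercube Q_n: vertices are the 0/1-vectors of length n (bool lists),
  edges join vectors differing in exactly one coordinate.
  A graph G with G a subgraph of Q_n is given by its edge set (edges are 2-element sets);
  its vertex set is that of Q_n.\<close>

definition cube_verts :: "nat \<Rightarrow> bool list set" where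
  "cube_verts n = {xs. length xs = n}"

definition cube_adj :: "nat \<Rightarrow> bool list \<Rightarrow> bool list \<Rightarrow> bool" where
  "cube_adj n x y \<longleftrightarrow> x \<in> cube_verts n \<and> y \<in> cube_verts n \<and>
     card {i. i < n \<and> x ! i \<noteq> y ! i} = 1"

definition cube_edges :: "nat \<Rightarrow> bool list set set" where
  "cube_edges n = {{x, y} | x y. cube_adj n x y}"

definition has_Q2 :: "'a set set \<Rightarrow> bool" where
  "has_Q2 E \<longleftrightarrow> (\<exists>a b c d. distinct [a, b, c, d] \<and>
     {a, b} \<in> E \<and> {b, c} \<in> E \<and> {c, d} \<in> E \<and> {d, a} \<in> E)"

definition Q2_saturated :: "nat \<Rightarrow> bool list set set \<Rightarrow> bool" where
  "Q2_saturated n E \<longleftrightarrow> E \<subseteq> cube_edges n \<and> \<not> has_Q2 E \<and>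
     (\<forall>e \<in> cube_edges n - E. has_Q2 (insert e E))"

definition sat_Q2 :: "nat \<Rightarrow> nat" where
  "sat_Q2 n = Min (card ` {E. Q2_saturated n E})"

end

theory Submission
  imports Defs
begin

text \<open>The coordinates are split into two blocks, each carrying a Hamming-type syndrome, the xor of
  the labels of the coordinates that are set. A few syndromes are declared code words of even or odd
  parity. Inside a block every vertex is joined to one code word of each parity, and these star
  edges are arranged to contain no $Q_2$. Where the syndrome of the other block is a code word,
  the block instead carries all edges away from its own code that lie between two consecutive
  layers of the matching parity; two opposite edges of a square have different parities, so these
  contain no $Q_2$ either. An edge that avoids the code of its block is then blocked: moving both ends to a
  code word of the right parity in the other block completes three sides of a square. Hence only
  the edges touching the code of their block and half of the edges over code words of the other
  block can occur in a saturated extension. Code words have density $3/2^r$ with $2^r$ of order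
  $n$, which leaves fewer than $10 \cdot 2^n$ edges.\<close>

section \<open>Saturation from a free graph\<close>

definition flip :: "nat \<Rightarrow> bool list \<Rightarrow> bool list" where
  "flip i x = x[i := \<not> x ! i]"

lemma length_flip [simp]: "length (flip i x) = length x"
  by (simp add: flip_def)

lemma nth_flip: "i < length x \<Longrightarrow> flip i x ! j = (if j = i then \<not> x ! i else x ! j)"
  by (simp add: flip_def nth_list_update)

lemma flip_flip [simp]: "flip i (flip i x) = x"
  by (cases "i < length x") (auto simp: flip_def list_update_beyond)

lemma flip_commute: "flip i (flip j x) = flip j (flip i x)"
  by (cases "i = j") (simp_all add: flip_def list_update_swap nth_list_update)

lemma flip_neq: "i < length x \<Longrightarrow> flip i x \<noteq> x"
  using nth_flip[of i x i] by fastforce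

lemma flip_eq_iff: "i < length x \<Longrightarrow> j < length x \<Longrightarrow> flip i x = flip j x \<longleftrightarrow> i = j"
  using nth_flip by metis

lemma inj_on_flip: "inj_on (flip i) A"
  by (metis flip_flip inj_onI)

text \<open>An edge is presented by a direction and one endpoint. Invariance of \<open>g i\<close>
  under \<open>flip i\<close> makes \<open>g\<close> a predicate on edges, whence the symmetry
  hypotheses below.\<close>

definition dir_edges :: "nat \<Rightarrow> (nat \<Rightarrow> bool list \<Rightarrow> bool) \<Rightarrow> bool list set set" where
  "dir_edges n g = {{x, flip i x} | x i. length x = n \<and> i < n \<and> g i x}"

lemma cube_adj_iff: "cube_adj n x y \<longleftrightarrow> length x = n \<and> (\<exists>i<n. y = flip i x)"
proof
  assume a: "cube_adj n x y"
  then have l: "length x = n" "length y = n" by (auto simp: cube_adj_def cube_verts_def)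
  from a obtain i where i: "{i. i < n \<and> x ! i \<noteq> y ! i} = {i}"
    by (auto simp: cube_adj_def card_1_singleton_iff)
  then have "i < n" by auto
  moreover have "y = flip i x"
  proof (rule nth_equalityI)
    fix j assume "j < length y"
    then show "y ! j = flip i x ! j" using i l \<open>i < n\<close> by (auto simp: nth_flip)
  qed (use l in simp)
  ultimately show "length x = n \<and> (\<exists>i<n. y = flip i x)" using l by auto
next
  assume "length x = n \<and> (\<exists>i<n. y = flip i x)"
  then obtain i where "length x = n" "i < n" "y = flip i x" by auto
  moreover from this have "{j. j < n \<and> x ! j \<noteq> y ! j} = {i}" by (auto simp: nth_flip)
  ultimately show "cube_adj n x y" by (auto simp: cube_adj_def cube_verts_def)
qed

lemma cube_edges_eq: "cube_edges n = dir_edges n (\<lambda>_ _. True)"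
  by (fastforce simp: cube_edges_def dir_edges_def cube_adj_iff)

lemma dir_edges_mono: "(\<And>i x. i < n \<Longrightarrow> length x = n \<Longrightarrow> g i x \<Longrightarrow> h i x) \<Longrightarrow> dir_edges n g \<subseteq> dir_edges n h"
  by (fastforce simp: dir_edges_def)

lemma finite_vertices: "finite {x :: bool list. length x = n}"
  using finite_lists_length_eq[of "UNIV :: bool set" n] by simp

lemma card_vertices: "card {x :: bool list. length x = n} = 2 ^ n"
  using card_lists_length_eq[of "UNIV :: bool set" n] by simp

lemma finite_cube_edges: "finite (cube_edges n)"
proof -
  have "cube_edges n \<subseteq> Pow {x. length x = n}"
    by (auto simp: cube_edges_eq dir_edges_def)
  then show ?thesis by (rule finite_subset) (simp add: finite_vertices)
qed

lemma dir_edges_doubleton: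
  assumes sym: "\<And>i x. i < n \<Longrightarrow> length x = n \<Longrightarrow> g i (flip i x) = g i x"
    and "{a, b} \<in> dir_edges n g"
  obtains i where "i < n" "length a = n" "b = flip i a" "g i a"
  using assms(2) sym by (auto simp: dir_edges_def doubleton_eq_iff)

text \<open>Every 4-cycle of the cube uses just two directions, each on a pair of opposite sides, so
  excluding coordinate squares is enough.\<close>

lemma dir_edges_Q2_free:
  assumes sym: "\<And>i x. i < n \<Longrightarrow> length x = n \<Longrightarrow> g i (flip i x) = g i x"
    and sq: "\<And>i j x. i < n \<Longrightarrow> j < n \<Longrightarrow> i \<noteq> j \<Longrightarrow> length x = n \<Longrightarrow>
      g i x \<Longrightarrow> g j x \<Longrightarrow> g i (flip j x) \<Longrightarrow> g j (flip i x) \<Longrightarrow> False"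
  shows "\<not> has_Q2 (dir_edges n g)"
proof
  assume "has_Q2 (dir_edges n g)"
  then obtain a b c d where dist: "distinct [a, b, c, d]"
    and E: "{a, b} \<in> dir_edges n g" "{b, c} \<in> dir_edges n g"
      "{c, d} \<in> dir_edges n g" "{d, a} \<in> dir_edges n g"
    unfolding has_Q2_def by blast
  obtain i where i: "i < n" "length a = n" "b = flip i a" "g i a"
    using dir_edges_doubleton[OF sym E(1)] by blast
  obtain j where j: "j < n" "length b = n" "c = flip j b" "g j b"
    using dir_edges_doubleton[OF sym E(2)] by blast
  obtain k where k: "k < n" "length c = n" "d = flip k c" "g k c"
    using dir_edges_doubleton[OF sym E(3)] by blast
  obtain l where l: "l < n" "length d = n" "a = flip l d" "g l d"
    using dir_edges_doubleton[OF sym E(4)] by blast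
  have d: "d = flip l a" using l(3) flip_flip by metis
  have ij: "i \<noteq> j" using dist i(3) j(3) by fastforce
  have jk: "j \<noteq> k" using dist j(3) k(3) by fastforce
  have il: "i \<noteq> l" using dist i(3) d by fastforce
  have eq: "flip k (flip j (flip i a)) = flip l a" using i(3) j(3) k(3) d by metis
  \<comment> \<open>Read at coordinate \<open>m\<close>, the flips in \<open>i\<close>,
    \<open>j\<close>, \<open>k\<close> together change it exactly when the flip in \<open>l\<close>
    does. Taking \<open>m\<close> to be \<open>i\<close> and then \<open>j\<close> identifies
    opposite directions.\<close>
  have nth: "(if m = k then \<not> (if m = j then \<not> (if m = i then \<not> a ! m else a ! m)
      else (if m = i then \<not> a ! m else a ! m)) else
      (if m = j then \<not> (if m = i then \<not> a ! m else a ! m)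
      else (if m = i then \<not> a ! m else a ! m)))
    = (if m = l then \<not> a ! m else a ! m)" for m
    using arg_cong[OF eq, of "\<lambda>x. x ! m"] i(1,2) j(1) k(1) l(1)
    by (simp add: nth_flip split: if_splits)
  have ki: "k = i" using nth[of i] ij il by (simp split: if_splits)
  have lj: "l = j" using nth[of j] ij jk by (simp split: if_splits)
  have "g i (flip i (flip j a))"
    using k(4) unfolding ki j(3) i(3) by (simp only: flip_commute[of j i])
  then have "g i (flip j a)" using sym[of i "flip j a"] i(1,2) by simp
  moreover have "g j a" using l(4) unfolding lj d using sym[of j a] i(2) j(1) by simp
  ultimately show False using sq[OF i(1) j(1) ij i(2) i(4)] j(4) unfolding i(3) by blast
qed

lemma insert_has_Q2:
  assumes len: "length x = n" "i < n" "j < n" "i \<noteq> j"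
    and g: "g j x" "g i (flip j x)" "g j (flip i x)"
  shows "has_Q2 (insert {x, flip i x} (dir_edges n g))"
  unfolding has_Q2_def
proof (intro exI conjI)
  have "flip j (flip i x) \<noteq> x" "flip i x \<noteq> flip j x"
    using len by (metis flip_eq_iff flip_flip length_flip)+
  moreover have "flip j (flip i x) \<noteq> flip i x" "flip j (flip i x) \<noteq> flip j x"
    using len flip_neq[of j "flip i x"] flip_neq[of i "flip j x"] by (simp_all add: flip_commute[of j i])
  ultimately show "distinct [x, flip i x, flip j (flip i x), flip j x]"
    using len flip_neq[of i x] flip_neq[of j x] by (auto simp del: flip_flip)
  show "{flip i x, flip j (flip i x)} \<in> insert {x, flip i x} (dir_edges n g)"
    using assms by (force simp: dir_edges_def)
  have "{flip j x, flip i (flip j x)} \<in> dir_edges n g"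
    using assms by (force simp: dir_edges_def)
  then show "{flip j (flip i x), flip j x} \<in> insert {x, flip i x} (dir_edges n g)"
    by (simp add: insert_commute flip_commute)
  have "{x, flip j x} \<in> dir_edges n g"
    using assms by (force simp: dir_edges_def)
  then show "{flip j x, x} \<in> insert {x, flip i x} (dir_edges n g)"
    by (simp add: insert_commute)
qed simp

lemma has_Q2_mono: "has_Q2 E \<Longrightarrow> E \<subseteq> F \<Longrightarrow> has_Q2 F"
  unfolding has_Q2_def by blast

text \<open>A maximal square-free graph between \<open>F\<close> and the cube is saturated;
  finiteness provides one.\<close>

lemma Q2_saturated_extension:
  assumes "F \<subseteq> cube_edges n" "\<not> has_Q2 F"
  obtains E where "F \<subseteq> E" "Q2_saturated n E"
proof -
  define S where "S = {E. F \<subseteq> E \<and> E \<subseteq> cube_edges n \<and> \<not> has_Q2 E}"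
  have "S \<subseteq> Pow (cube_edges n)" by (auto simp: S_def)
  then have fin: "finite S"
    by (rule finite_subset) (simp add: finite_cube_edges)
  have "F \<in> S" using assms by (simp add: S_def)
  from finite_has_maximal2[OF fin this] obtain E
    where E: "E \<in> S" and max: "\<forall>E'\<in>S. E \<subseteq> E' \<longrightarrow> E = E'"
    by metis
  have "has_Q2 (insert e E)" if e: "e \<in> cube_edges n - E" for e
  proof (rule ccontr)
    assume "\<not> has_Q2 (insert e E)"
    then have "insert e E \<in> S" using E e by (simp add: S_def subset_insertI2)
    then have "E = insert e E" using max subset_insertI by metis
    then show False using e by blast
  qed
  then have "Q2_saturated n E" using E by (simp add: Q2_saturated_def S_def)
  moreover have "F \<subseteq> E" using E by (simp add: S_def)
  ultimately show thesis using that by metis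
qed

text \<open>An edge outside \<open>X\<close> would close a square with \<open>F\<close> alone, so
  every saturated extension of \<open>F\<close> stays inside \<open>X\<close>. It remains to find a
  good \<open>F\<close> and to count \<open>X\<close>.\<close>

lemma sat_Q2_le:
  assumes F: "F \<subseteq> cube_edges n" "\<not> has_Q2 F"
    and X: "X \<subseteq> cube_edges n" "F \<subseteq> X"
    and blocked: "\<And>e. e \<in> cube_edges n \<Longrightarrow> e \<notin> X \<Longrightarrow> has_Q2 (insert e F)"
  shows "sat_Q2 n \<le> card X"
proof -
  obtain E where E: "F \<subseteq> E" "Q2_saturated n E"
    using Q2_saturated_extension[OF F] .
  have "E \<subseteq> X"
  proof
    fix e assume "e \<in> E"
    then have "e \<in> cube_edges n" "\<not> has_Q2 (insert e F)"
      using E has_Q2_mono[of "insert e F" E] by (auto simp: Q2_saturated_def)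
    then show "e \<in> X" using blocked by blast
  qed
  then have "card E \<le> card X"
    using X finite_cube_edges by (meson card_mono finite_subset)
  moreover have "finite {E. Q2_saturated n E}"
    by (rule finite_subset[of _ "Pow (cube_edges n)"])
      (auto simp: finite_cube_edges Q2_saturated_def)
  then have "sat_Q2 n \<le> card E"
    unfolding sat_Q2_def using E by (intro Min_le) auto
  ultimately show ?thesis by simp
qed

section \<open>Counting edges by direction\<close>

lemma double_card_le:
  assumes "finite C" "inj_on f A" "A \<subseteq> C" "f ` A \<subseteq> C" "A \<inter> f ` A = {}"
  shows "2 * card A \<le> card C"
proof -
  have "card (A \<union> f ` A) = 2 * card A"
    using assms finite_subset[OF assms(3,1)] by (simp add: card_Un_disjoint card_image)
  then show ?thesis using card_mono[of C "A \<union> f ` A"] assms by auto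
qed

text \<open>Each edge is charged to its endpoint with coordinate \<open>i\<close> false;
  \<open>flip i\<close> pairs these endpoints with the other ones.\<close>

lemma card_dir_edges_le:
  assumes sym: "\<And>i x. i < n \<Longrightarrow> length x = n \<Longrightarrow> g i (flip i x) = g i x"
  shows "2 * card (dir_edges n g) \<le> (\<Sum>i<n. card {x. length x = n \<and> g i x})"
proof -
  let ?L = "\<lambda>i. {x. length x = n \<and> g i x \<and> \<not> x ! i}"
  have sub: "dir_edges n g \<subseteq> (\<Union>i<n. (\<lambda>x. {x, flip i x}) ` ?L i)"
  proof
    fix e assume "e \<in> dir_edges n g"
    then obtain x i where x: "e = {x, flip i x}" "length x = n" "i < n" "g i x"
      by (auto simp: dir_edges_def)
    show "e \<in> (\<Union>i<n. (\<lambda>x. {x, flip i x}) ` ?L i)"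
    proof (cases "x ! i")
      case True
      then have "flip i x \<in> ?L i" "e = {flip i x, flip i (flip i x)}"
        using x sym[of i x] by (auto simp: nth_flip)
      then show ?thesis using x(3) by blast
    next
      case False
      then show ?thesis using x by blast
    qed
  qed
  have fin: "finite (?L i)" for i
    by (rule finite_subset[OF _ finite_vertices[of n]]) auto
  have "card (dir_edges n g) \<le> card (\<Union>i<n. (\<lambda>x. {x, flip i x}) ` ?L i)"
    using fin by (intro card_mono[OF _ sub]) auto
  also have "\<dots> \<le> (\<Sum>i<n. card ((\<lambda>x. {x, flip i x}) ` ?L i))"
    by (rule card_UN_le) simp
  also have "\<dots> \<le> (\<Sum>i<n. card (?L i))"
    by (intro sum_mono card_image_le fin)
  finally have "2 * card (dir_edges n g) \<le> (\<Sum>i<n. 2 * card (?L i))"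
    by (simp add: sum_distrib_left[symmetric])
  also have "\<dots> \<le> (\<Sum>i<n. card {x. length x = n \<and> g i x})"
  proof (rule sum_mono, rule double_card_le)
    fix i assume i: "i \<in> {..<n}"
    show "inj_on (flip i) (?L i)" by (rule inj_on_flip)
    show "finite {x. length x = n \<and> g i x}"
      by (rule finite_subset[OF _ finite_vertices[of n]]) auto
    show "flip i ` ?L i \<subseteq> {x. length x = n \<and> g i x}" using i sym by auto
    have "flip i x \<notin> ?L i" if "x \<in> ?L i" for x
      using that i by (auto simp: nth_flip)
    then show "?L i \<inter> flip i ` ?L i = {}" by blast
  qed auto
  finally show ?thesis .
qed

section \<open>Syndromes\<close>

text \<open>Shifting \<open>l\<close> in the recursion keeps each label attached to its original
  position.\<close>

fun syndrome :: "(nat \<Rightarrow> nat) \<Rightarrow> bool list \<Rightarrow> nat" where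
  "syndrome l [] = 0"
| "syndrome l (b # x) = xor (if b then l 0 else 0) (syndrome (\<lambda>i. l (Suc i)) x)"

lemma syndrome_flip:
  "i < length x \<Longrightarrow> syndrome l (flip i x) = xor (syndrome l x) (l i)"
proof (induction x arbitrary: i l)
  case (Cons b x)
  show ?case
  proof (cases i)
    case 0
    then show ?thesis by (simp add: flip_def xor.commute[of _ "l 0"] xor.assoc[symmetric])
  next
    case (Suc j)
    then have "flip i (b # x) = b # flip j x" by (simp add: flip_def)
    then show ?thesis using Cons Suc by (simp add: ac_simps)
  qed
qed simp

lemma xor_less_power_two:
  fixes a b :: nat
  assumes "a < 2 ^ r" "b < 2 ^ r"
  shows "xor a b < 2 ^ r"
  using assms by (metis take_bit_nat_eq_self_iff take_bit_xor)

lemma syndrome_less: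
  "(\<And>i. i < length x \<Longrightarrow> l i < 2 ^ r) \<Longrightarrow> syndrome l x < 2 ^ r"
proof (induction x arbitrary: l)
  case (Cons b x)
  have "syndrome (\<lambda>i. l (Suc i)) x < 2 ^ r"
    using Cons.prems by (intro Cons.IH) auto
  then show ?case using Cons.prems[of 0] by (auto intro: xor_less_power_two)
qed simp

section \<open>Two interlocking codes\<close>

text \<open>Syndromes 0 and 2 are the even code words and syndrome 1 is the odd one. With a single even
  syndrome, the even and the odd code word next to a vertex would always have a second common
  neighbour, closing a $Q_2$. Letting the parity of a vertex choose between 0 and 2 excludes this,
  because the syndromes around a square contain an even number of odd ones.\<close>

definition star :: "nat \<Rightarrow> nat \<Rightarrow> bool" where
  "star a b \<longleftrightarrow> a \<noteq> b \<and> (a = 1 \<or> b = 1 \<or> (a = 0 \<and> even b \<and> b \<noteq> 2) \<or> (b = 0 \<and> even a \<and> a \<noteq> 2)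
    \<or> (a = 2 \<and> odd b) \<or> (b = 2 \<and> odd a))"

abbreviation code :: "nat \<Rightarrow> bool" where
  "code a \<equiv> a < 3"

lemma code_iff: "code a \<longleftrightarrow> a = 0 \<or> a = 1 \<or> a = 2"
  by auto

lemma star_sym: "star a b \<longleftrightarrow> star b a"
  unfolding star_def by metis

lemma star_irrefl: "\<not> star a a"
  by (simp add: star_def)

lemma star_code: "star a b \<Longrightarrow> code a \<or> code b"
  unfolding star_def by auto

text \<open>0 and 2 are never joined, so joined code words always include 1. This excludes squares
  that span both blocks.\<close>

lemma star_parity: "star a b \<Longrightarrow> code a \<Longrightarrow> code b \<Longrightarrow> odd a \<noteq> odd b"
  unfolding star_def code_iff by auto

text \<open>The odd code word is 1; the even one is 0 or 2 according to the parity of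
  \<open>a\<close>. This provides the detour used in \<open>blocked\<close>.\<close>

lemma star_to_code:
  assumes "\<not> (code a \<and> odd a = k)"
  obtains d where "code d" "odd d = k" "star a d"
proof (cases k)
  case True
  then have "star a 1" using assms by (auto simp: star_def code_iff)
  then show thesis using that[of 1] True by simp
next
  case False
  then have "star a (if even a then 0 else 2)"
    using assms by (cases "even a") (auto simp: star_def code_iff odd_pos)
  then show thesis using that[of "if even a then 0 else 2"] False by (simp split: if_splits)
qed

text \<open>Every side has a code end, so two opposite corners are both code words. The common
  neighbours of 0 and 1 are all even, those of 1 and 2 all odd, and both contradict the parity
  condition; 0 and 2 have only the common neighbour 1.\<close>

lemma star_no_cycle:
  assumes "star a b" "star b c" "star c d" "star d a" "a \<noteq> c" "b \<noteq> d"
    and "(odd a = odd b) = (odd c = odd d)"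
  shows False
proof -
  have star_0: "star 0 u \<longleftrightarrow> u = 1 \<or> (even u \<and> u \<noteq> 0 \<and> u \<noteq> 2)"
    and star_1: "star 1 u \<longleftrightarrow> u \<noteq> 1" and star_2: "star 2 u \<longleftrightarrow> odd u" for u
    unfolding star_def by auto
  have opposite: False
    if s: "star p u" "star p v" "star q u" "star q v" "u \<noteq> v" "p \<noteq> q"
      and pq: "code p" "code q" and par: "(odd p = odd u) = (odd q = odd v)" for p q u v
    using pq s par unfolding code_iff
    by (elim disjE; auto simp: star_0 star_1[unfolded One_nat_def] star_2)
  have "code a \<and> code c \<or> code b \<and> code d"
    using star_code[OF assms(1)] star_code[OF assms(2)] star_code[OF assms(3)] star_code[OF assms(4)]
    by argo
  then show False
  proof
    assume "code a \<and> code c"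
    then show False
      using opposite[of a b d c] assms star_sym[of b c] star_sym[of d a] by simp
  next
    assume "code b \<and> code d"
    then show False
      using opposite[of b a c d] assms star_sym[of a b] star_sym[of c d] by auto
  qed
qed

text \<open>Coordinates beyond the nonzero labels of a block get label 0.\<close>

locale two_codes =
  fixes n :: nat and e :: "bool \<Rightarrow> nat" and blk :: "nat \<Rightarrow> bool" and lab :: "nat \<Rightarrow> nat"
  assumes e_ge: "2 \<le> e c"
    and lab_less: "i < n \<Longrightarrow> lab i < 2 ^ e (blk i)"
    and lab_inj: "i < n \<Longrightarrow> j < n \<Longrightarrow> blk i = blk j \<Longrightarrow> lab i = lab j \<Longrightarrow> lab i \<noteq> 0 \<Longrightarrow> i = j"
    and lab_surj: "0 < a \<Longrightarrow> a < 2 ^ e c \<Longrightarrow> \<exists>j<n. blk j = c \<and> lab j = a"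
begin

definition syn :: "bool \<Rightarrow> bool list \<Rightarrow> nat" where
  "syn c = syndrome (\<lambda>i. if blk i = c then lab i else 0)"

text \<open>An xor of ones: the parity of the number of set coordinates in block
  \<open>c\<close>.\<close>

definition par :: "bool \<Rightarrow> bool list \<Rightarrow> bool" where
  "par c x \<longleftrightarrow> odd (syndrome (\<lambda>i. if blk i = c then 1 else 0) x)"

text \<open>The parity, within its block, of the layers joined by the edge at \<open>x\<close> in direction \<open>i\<close>:
  the coordinate \<open>i\<close> itself is left out, so both ends agree.\<close>

definition edge_bit :: "nat \<Rightarrow> bool list \<Rightarrow> bool" where
  "edge_bit i x \<longleftrightarrow> par (blk i) x \<noteq> x ! i"

text \<open>A move in direction \<open>i\<close> leaves \<open>t\<close> fixed, so both ends of an
  edge use the same branch: layer edges over code words, star edges elsewhere.\<close>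

definition base :: "nat \<Rightarrow> bool list \<Rightarrow> bool" where
  "base i x \<longleftrightarrow> (let c = blk i; a = syn c x; b = syn c (flip i x); t = syn (\<not> c) x in
     if code t then \<not> code a \<and> \<not> code b \<and> edge_bit i x = odd t else star a b)"

text \<open>The edges that the extension of \<open>base\<close> to a saturated graph may use.\<close>

definition cover :: "nat \<Rightarrow> bool list \<Rightarrow> bool" where
  "cover i x \<longleftrightarrow> code (syn (blk i) x) \<or> code (syn (blk i) (flip i x)) \<or>
     (code (syn (\<not> blk i) x) \<and> edge_bit i x = odd (syn (\<not> blk i) x))"

lemma syn_flip:
  "i < length x \<Longrightarrow> syn c (flip i x) = (if blk i = c then xor (syn c x) (lab i) else syn c x)"
  by (simp add: syn_def syndrome_flip)

lemma syn_less: "length x = n \<Longrightarrow> syn c x < 2 ^ e c"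
  unfolding syn_def using lab_less by (intro syndrome_less) auto

lemma par_flip: "i < length x \<Longrightarrow> par c (flip i x) = (par c x \<noteq> (blk i = c))"
  by (auto simp: par_def syndrome_flip even_xor_iff)

lemma bit_flip:
  "i < length x \<Longrightarrow> j < length x \<Longrightarrow> edge_bit i (flip j x) = (edge_bit i x \<noteq> (i \<noteq> j \<and> blk i = blk j))"
  by (auto simp: edge_bit_def par_flip nth_flip)

lemma base_sym: "i < n \<Longrightarrow> length x = n \<Longrightarrow> base i (flip i x) = base i x"
  using star_sym by (auto simp: base_def Let_def bit_flip syn_flip[of i x "\<not> blk i"])

lemma cover_sym: "i < n \<Longrightarrow> length x = n \<Longrightarrow> cover i (flip i x) = cover i x"
  by (auto simp: cover_def bit_flip syn_flip[of i x "\<not> blk i"])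

lemma base_cover: "base i x \<Longrightarrow> cover i x"
  using star_code by (auto simp: base_def cover_def Let_def split: if_splits)

section \<open>The base graph has no square and blocks every edge outside
  \<open>cover\<close>\<close>

lemma base_no_square:
  assumes i: "i < n" and j: "j < n" and ij: "i \<noteq> j" and x: "length x = n"
    and b: "base i x" "base j x" "base i (flip j x)" "base j (flip i x)"
  shows False
proof (cases "blk i = blk j")
  case True
  let ?c = "blk i" and ?a = "syn (blk i) x"
  have other: "syn (\<not> ?c) (flip j x) = syn (\<not> ?c) x" "syn (\<not> ?c) (flip i x) = syn (\<not> ?c) x"
    using i j x True by (simp_all add: syn_flip)
  have own: "syn ?c (flip i x) = xor ?a (lab i)" "syn ?c (flip j x) = xor ?a (lab j)"
      "syn ?c (flip i (flip j x)) = xor (xor ?a (lab j)) (lab i)"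
      "syn ?c (flip j (flip i x)) = xor (xor ?a (lab j)) (lab i)"
    using i j x True by (simp_all add: syn_flip xor.assoc xor.commute[of "lab i"])
  show False
  proof (cases "code (syn (\<not> ?c) x)")
    \<comment> \<open>Flipping \<open>j\<close> in the same block moves the edge in direction
      \<open>i\<close> to the next layer, so two opposite sides cannot both have the required
      parity.\<close>
    case t: True
    then have "edge_bit i x = odd (syn (\<not> ?c) x)" "edge_bit i (flip j x) = odd (syn (\<not> ?c) x)"
      using b other by (auto simp: base_def Let_def)
    then show False using i j x ij True by (simp add: bit_flip)
  next
    case False
    then have s: "star ?a (xor ?a (lab i))" "star ?a (xor ?a (lab j))"
        "star (xor ?a (lab j)) (xor (xor ?a (lab j)) (lab i))"
        "star (xor ?a (lab i)) (xor (xor ?a (lab j)) (lab i))"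
      using b other own True by (auto simp: base_def Let_def)
    \<comment> \<open>Star edges change the syndrome, so both labels are nonzero and hence distinct.
      Opposite corners of the square then have different syndromes.\<close>
    have nz: "lab i \<noteq> 0" "lab j \<noteq> 0" using s(1,2) star_irrefl by (metis xor.right_neutral)+
    have ne: "lab i \<noteq> lab j" using lab_inj[OF i j True] ij nz by auto
    have cancel: "xor (xor ?a u) ?a = u" for u
      by (metis xor.assoc xor.commute xor.right_neutral xor_self_eq)
    have "xor ?a (lab i) \<noteq> xor ?a (lab j)" using ne cancel by metis
    moreover have "?a \<noteq> xor (xor ?a (lab j)) (lab i)"
      using ne by (metis xor.assoc xor.right_neutral xor_self_eq)
    ultimately show False
      using star_no_cycle[of ?a "xor ?a (lab i)" "xor (xor ?a (lab j)) (lab i)" "xor ?a (lab j)"]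
        s star_sym by (auto simp: even_xor_iff)
  qed
next
  case False
  then have c: "blk j = (\<not> blk i)" by auto
  let ?a = "syn (blk i) x" and ?b = "syn (blk i) (flip i x)"
  let ?t = "syn (\<not> blk i) x" and ?u = "syn (\<not> blk i) (flip j x)"
  have eq: "syn (blk i) (flip j x) = ?a" "syn (blk i) (flip i (flip j x)) = ?b"
      "syn (\<not> blk i) (flip i x) = ?t" "syn (\<not> blk i) (flip j (flip i x)) = ?u"
      "edge_bit i (flip j x) = edge_bit i x" "edge_bit j (flip i x) = edge_bit j x"
    using i j x c by (simp_all add: syn_flip bit_flip)
  have "if code ?t then \<not> code ?a \<and> \<not> code ?b \<and> edge_bit i x = odd ?t else star ?a ?b"
      "if code ?u then \<not> code ?a \<and> \<not> code ?b \<and> edge_bit i x = odd ?u else star ?a ?b"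
      "if code ?a then \<not> code ?t \<and> \<not> code ?u \<and> edge_bit j x = odd ?a else star ?t ?u"
      "if code ?b then \<not> code ?t \<and> \<not> code ?u \<and> edge_bit j x = odd ?b else star ?t ?u"
    using b unfolding base_def Let_def c not_not eq by blast+
  \<comment> \<open>A code word among \<open>?t\<close>, \<open>?u\<close> forbids code words among
    \<open>?a\<close>, \<open>?b\<close>, and conversely. A pair without a code word makes the other
    pair star-joined, hence containing a code word; two code words there would need equal parity,
    against \<open>star_parity\<close>.\<close>
  then show False
    using star_code[of ?a ?b] star_code[of ?t ?u] star_parity[of ?a ?b] star_parity[of ?t ?u]
    by argo
qed

text \<open>Flipping \<open>j\<close> moves the other block to a code word \<open>d\<close> whose
  parity matches the edge. The two sides in direction \<open>j\<close> are star edges, and the side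
  opposite to the given edge is a layer edge over \<open>d\<close>.\<close>

lemma blocked:
  assumes i: "i < n" and x: "length x = n" and nc: "\<not> cover i x"
  obtains j where "j < n" "j \<noteq> i" "base j x" "base i (flip j x)" "base j (flip i x)"
proof -
  let ?c = "blk i"
  let ?t = "syn (\<not> ?c) x"
  have nc': "\<not> code (syn ?c x)" "\<not> code (syn ?c (flip i x))" "\<not> (code ?t \<and> odd ?t = edge_bit i x)"
    using nc by (auto simp: cover_def)
  obtain d where d: "code d" "odd d = edge_bit i x" "star ?t d"
    using star_to_code[OF nc'(3)] .
  \<comment> \<open>At least two bits are available, so 0, 1 and 2 all occur as syndromes.\<close>
  have "(2::nat) ^ 2 \<le> 2 ^ e (\<not> ?c)" using e_ge by (intro power_increasing) auto
  then have "d < 2 ^ e (\<not> ?c)" using d(1) by simp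
  then have "xor ?t d < 2 ^ e (\<not> ?c)" by (intro xor_less_power_two syn_less x)
  moreover have cancel: "xor ?t (xor ?t d) = d"
    by (simp add: xor.assoc[symmetric])
  then have "xor ?t d \<noteq> 0" using d(3) star_irrefl by (metis xor.right_neutral)
  ultimately obtain j where j: "j < n" "blk j = (\<not> ?c)" "lab j = xor ?t d"
    using lab_surj[of "xor ?t d" "\<not> ?c"] by auto
  have eq: "syn (\<not> ?c) (flip j x) = d" "syn ?c (flip j x) = syn ?c x"
    "syn ?c (flip i (flip j x)) = syn ?c (flip i x)"
    "syn (\<not> ?c) (flip j (flip i x)) = d" "syn (\<not> ?c) (flip i x) = ?t"
    "edge_bit i (flip j x) = edge_bit i x"
    using i j x cancel by (simp_all add: syn_flip bit_flip)
  have "j \<noteq> i" using j by auto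
  moreover have "base j x" "base i (flip j x)" "base j (flip i x)"
    unfolding base_def Let_def using nc' d j eq by simp_all
  ultimately show thesis using that j by blast
qed

lemma sat_le_cover: "sat_Q2 n \<le> card (dir_edges n cover)"
proof (rule sat_Q2_le)
  show "dir_edges n base \<subseteq> cube_edges n" "dir_edges n cover \<subseteq> cube_edges n"
    "dir_edges n base \<subseteq> dir_edges n cover"
    unfolding cube_edges_eq by (rule dir_edges_mono, simp add: base_cover)+
  show "\<not> has_Q2 (dir_edges n base)"
    using base_sym base_no_square by (rule dir_edges_Q2_free)
  fix edge assume "edge \<in> cube_edges n" "edge \<notin> dir_edges n cover"
  then obtain x i where x: "edge = {x, flip i x}" "length x = n" "i < n" "\<not> cover i x"
    by (auto simp: cube_edges_eq dir_edges_def)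
  then obtain j where "j < n" "j \<noteq> i" "base j x" "base i (flip j x)" "base j (flip i x)"
    using blocked by metis
  then show "has_Q2 (insert edge (dir_edges n base))"
    using x insert_has_Q2[of x n i j base] by auto
qed

section \<open>Code density and the number of edges in \<open>cover\<close>\<close>

text \<open>Flipping the coordinate labelled \<open>xor a b\<close> injects the fibre over
  \<open>a\<close> into the fibre over \<open>b\<close>, so no fibre exceeds the average
  size.\<close>

lemma card_fibre_le:
  assumes a: "a < 2 ^ e c"
  shows "2 ^ e c * card {x. length x = n \<and> syn c x = a} \<le> 2 ^ n"
proof -
  let ?F = "\<lambda>b. {x. length x = n \<and> syn c x = b}"
  have fin: "finite (?F b)" for b
    by (rule finite_subset[OF _ finite_vertices[of n]]) auto
  have le: "card (?F a) \<le> card (?F b)" if b: "b < 2 ^ e c" for b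
  proof (cases "a = b")
    case False
    have cancel: "xor a (xor a b) = b" by (simp add: xor.assoc[symmetric])
    then have "xor a b \<noteq> 0" using False by (metis xor.right_neutral)
    then obtain j where j: "j < n" "blk j = c" "lab j = xor a b"
      using lab_surj[of "xor a b" c] xor_less_power_two[OF a b] by blast
    show ?thesis
      by (rule card_inj_on_le[OF inj_on_flip[of j]]) (use j cancel fin in \<open>auto simp: syn_flip\<close>)
  qed simp
  have "2 ^ e c * card (?F a) = (\<Sum>b<(2::nat) ^ e c. card (?F a))" by simp
  also have "\<dots> \<le> (\<Sum>b<2 ^ e c. card (?F b))" using le by (intro sum_mono) auto
  also have "\<dots> = card (\<Union>b<2 ^ e c. ?F b)"
    using fin by (intro card_UN_disjoint[symmetric]) auto
  also have "\<dots> \<le> card {x :: bool list. length x = n}"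
    by (intro card_mono finite_vertices) auto
  finally show ?thesis by (simp add: card_vertices)
qed

lemma card_code_le:
  assumes "e c \<le> n"
  shows "card {x. length x = n \<and> code (syn c x)} \<le> 3 * 2 ^ (n - e c)"
proof -
  have "(2::nat) ^ 2 \<le> 2 ^ e c" using e_ge by (intro power_increasing) auto
  then have le: "card {x. length x = n \<and> syn c x = a} \<le> 2 ^ (n - e c)" if "a < 3" for a
    using card_fibre_le[of a c] that power_add[of "2::nat" "e c" "n - e c"] assms by simp
  have "{x. length x = n \<and> code (syn c x)} = (\<Union>a<3. {x. length x = n \<and> syn c x = a})"
    by auto
  then have "card {x. length x = n \<and> code (syn c x)} \<le> (\<Sum>a<3. card {x. length x = n \<and> syn c x = a})"
    using card_UN_le[of "{..<3}" "\<lambda>a. {x. length x = n \<and> syn c x = a}"] by simp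
  also have "\<dots> \<le> (\<Sum>a<(3::nat). 2 ^ (n - e c))" using le by (intro sum_mono) auto
  finally show ?thesis by simp
qed

text \<open>Edges touching their own code contribute the two sets \<open>?A\<close> and
  \<open>?B\<close>, which coincide for label 0. The layer condition \<open>?D\<close> keeps at most
  half of the vertices over the other code.\<close>

lemma card_cover_le:
  assumes i: "i < n" and en: "\<And>c. e c \<le> n"
  shows "2 * card {x. length x = n \<and> cover i x} \<le>
    (if lab i = 0 then 6 else 12) * 2 ^ (n - e (blk i)) + 3 * 2 ^ (n - e (\<not> blk i))"
proof -
  let ?c = "blk i"
  let ?A = "{x. length x = n \<and> code (syn ?c x)}"
  let ?B = "{x. length x = n \<and> code (syn ?c (flip i x))}"
  let ?C = "{x. length x = n \<and> code (syn (\<not> ?c) x)}"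
  let ?D = "{x. length x = n \<and> code (syn (\<not> ?c) x) \<and> edge_bit i x = odd (syn (\<not> ?c) x)}"
  have fin: "finite {x. length x = n \<and> P x}" for P :: "bool list \<Rightarrow> bool"
    by (rule finite_subset[OF _ finite_vertices[of n]]) auto
  have "card ?B \<le> card ?A"
    by (rule card_inj_on_le[OF inj_on_flip[of i]]) (auto simp: fin)
  moreover have "card (?A \<union> ?B) \<le> card ?A + card ?B" by (rule card_Un_le)
  moreover have "?B = ?A" if "lab i = 0" using that i by (auto simp: syn_flip)
  ultimately have own: "card (?A \<union> ?B) \<le> (if lab i = 0 then 1 else 2) * card ?A"
    by auto
  have "card {x. length x = n \<and> cover i x} \<le> card ((?A \<union> ?B) \<union> ?D)"
    by (intro card_mono) (auto simp: fin cover_def)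
  also have "\<dots> \<le> card (?A \<union> ?B) + card ?D" by (rule card_Un_le)
  finally have split: "card {x. length x = n \<and> cover i x} \<le> card (?A \<union> ?B) + card ?D" .
  \<comment> \<open>Labels 1 and 2 give two coordinates in the block, so one differs from
    \<open>i\<close>. Flipping it toggles \<open>edge_bit\<close> and fixes the other
    syndrome.\<close>
  have "(2::nat) ^ 2 \<le> 2 ^ e ?c" using e_ge by (intro power_increasing) auto
  then obtain j1 j2 where "j1 < n" "blk j1 = ?c" "lab j1 = 1" "j2 < n" "blk j2 = ?c" "lab j2 = 2"
    using lab_surj[of 1 ?c] lab_surj[of 2 ?c] by auto
  then obtain j where j: "j < n" "blk j = ?c" "j \<noteq> i"
    by (metis numeral_eq_one_iff semiring_norm(85))
  have half: "2 * card ?D \<le> card ?C"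
  proof (rule double_card_le[OF fin inj_on_flip[of j]])
    show "?D \<subseteq> ?C" "flip j ` ?D \<subseteq> ?C" using j by (auto simp: syn_flip)
    have "flip j x \<notin> ?D" if "x \<in> ?D" for x
      using that i j by (auto simp: syn_flip bit_flip)
    then show "?D \<inter> flip j ` ?D = {}" by blast
  qed
  show ?thesis
    using split own half card_code_le[OF en, of ?c] card_code_le[OF en, of "\<not> ?c"]
    by (auto split: if_splits)
qed

text \<open>One factor 2 comes from the two ends of an edge, the other from the doubled count in
  \<open>card_cover_le\<close>.\<close>

lemma sat_le_sum:
  assumes "\<And>c. e c \<le> n"
  shows "4 * sat_Q2 n \<le> (\<Sum>i<n. (if lab i = 0 then 6 else 12) * 2 ^ (n - e (blk i))
    + 3 * 2 ^ (n - e (\<not> blk i)))"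
proof -
  have "4 * sat_Q2 n \<le> 2 * (2 * card (dir_edges n cover))"
    using sat_le_cover by simp
  also have "\<dots> \<le> 2 * (\<Sum>i<n. card {x. length x = n \<and> cover i x})"
    using card_dir_edges_le[of n cover] cover_sym by (intro mult_le_mono) auto
  also have "\<dots> = (\<Sum>i<n. 2 * card {x. length x = n \<and> cover i x})"
    by (simp add: sum_distrib_left)
  also have "\<dots> \<le> (\<Sum>i<n. (if lab i = 0 then 6 else 12) * 2 ^ (n - e (blk i))
      + 3 * 2 ^ (n - e (\<not> blk i)))"
    using card_cover_le assms by (intro sum_mono) auto
  finally show ?thesis .
qed

end

section \<open>Choice of block sizes and numerical estimates\<close>

lemma sat_Q2_code_bound:
  assumes r: "2 \<le> r" "2 \<le> r'" and n: "2 ^ r + 2 ^ r' \<le> n + (2::nat)"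
  defines "q \<equiv> 2 ^ r" and "q' \<equiv> 2 ^ r'" and "K \<equiv> 2 ^ (n - r)" and "K' \<equiv> 2 ^ (n - r')"
  shows "4 * sat_Q2 n \<le> (q - 1) * (12 * K + 3 * K') + (q' - 1) * (12 * K' + 3 * K)
    + (n + 2 - (q + q')) * (6 * K' + 3 * K)"
    and "q * K = 2 ^ n" and "q' * K' = 2 ^ n"
proof -
  define e where "e = (\<lambda>c. if c then r' else r)"
  \<comment> \<open>The first \<open>q - 1\<close> coordinates carry the nonzero labels of one
    block, the next \<open>q' - 1\<close> those of the other; the remaining ones join the second
    block with label 0. These ranges give the three terms of the bound.\<close>
  define blk where "blk = (\<lambda>i. q - 1 \<le> i)"
  define lab where "lab = (\<lambda>i. if i < q - 1 then i + 1 else if i < q + q' - 2 then i + 2 - q else 0)"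
  have q4: "4 \<le> q" "4 \<le> q'"
    using power_increasing[of 2 r "2::nat"] power_increasing[of 2 r' "2::nat"] r
    by (simp_all add: q_def q'_def)
  have qe: "2 ^ e c = (if c then q' else q)" for c
    by (simp add: e_def q_def q'_def)
  have nq: "q + q' \<le> n + 2" using n by (simp add: q_def q'_def)
  interpret two_codes n e blk lab
  proof
    show "2 \<le> e c" for c using r by (simp add: e_def)
    show "lab i < 2 ^ e (blk i)" for i
      using q4 by (auto simp: qe lab_def blk_def)
    show "i = j" if "blk i = blk j" "lab i = lab j" "lab i \<noteq> 0" for i j
      using that q4 by (auto simp: lab_def blk_def split: if_splits)
    show "\<exists>j<n. blk j = c \<and> lab j = a" if "0 < a" "a < 2 ^ e c" for a c
    proof (cases c)
      case True
      then show ?thesis using that q4 nq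
        by (intro exI[of _ "a + q - 2"]) (auto simp: qe lab_def blk_def)
    next
      case False
      then show ?thesis using that q4 nq
        by (intro exI[of _ "a - 1"]) (auto simp: qe lab_def blk_def)
    qed
  qed
  have rn: "r \<le> n" "r' \<le> n"
    using less_exp[of r] less_exp[of r'] q4 nq unfolding q_def q'_def by linarith+
  show "q * K = 2 ^ n" "q' * K' = 2 ^ n"
    unfolding q_def q'_def K_def K'_def using rn by (simp_all flip: power_add)
  let ?f = "\<lambda>i. (if lab i = 0 then 6 else 12) * 2 ^ (n - e (blk i)) + 3 * 2 ^ (n - e (\<not> blk i))"
  have "?f i = 12 * K + 3 * K'" if "i \<in> {0..<q - 1}" for i
    using that q4 by (auto simp: lab_def blk_def e_def K_def K'_def)
  then have s1: "sum ?f {0..<q - 1} = (q - 1) * (12 * K + 3 * K')"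
    by simp
  have "?f i = 12 * K' + 3 * K" if "i \<in> {q - 1..<q + q' - 2}" for i
    using that q4 by (auto simp: lab_def blk_def e_def K_def K'_def)
  then have s2: "sum ?f {q - 1..<q + q' - 2} = (q' - 1) * (12 * K' + 3 * K)"
    using q4 by simp
  have "?f i = 6 * K' + 3 * K" if "i \<in> {q + q' - 2..<n}" for i
    using that q4 by (auto simp: lab_def blk_def e_def K_def K'_def)
  then have s3: "sum ?f {q + q' - 2..<n} = (n + 2 - (q + q')) * (6 * K' + 3 * K)"
    using q4 nq by simp
  have "4 * sat_Q2 n \<le> sum ?f {0..<n}"
    using sat_le_sum rn by (simp add: e_def lessThan_atLeast0)
  also have "sum ?f {0..<n} = sum ?f {0..<q - 1} + sum ?f {q - 1..<n}"
    using q4 nq by (intro sum.atLeastLessThan_concat[symmetric]) auto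
  also have "sum ?f {q - 1..<n} = sum ?f {q - 1..<q + q' - 2} + sum ?f {q + q' - 2..<n}"
    using q4 nq by (intro sum.atLeastLessThan_concat[symmetric]) auto
  finally show "4 * sat_Q2 n \<le> (q - 1) * (12 * K + 3 * K') + (q' - 1) * (12 * K' + 3 * K)
      + (n + 2 - (q + q')) * (6 * K' + 3 * K)"
    unfolding s1 s2 s3 by (simp only: add.assoc)
qed

lemma sat_Q2_le_cube: "2 * sat_Q2 n \<le> n * 2 ^ n"
proof -
  have "sat_Q2 n \<le> card (cube_edges n)"
    by (rule sat_Q2_le[of "{}"]) (auto simp: has_Q2_def)
  moreover have "2 * card (cube_edges n) \<le> n * 2 ^ n"
    using card_dir_edges_le[of n "\<lambda>_ _. True"] by (simp add: cube_edges_eq card_vertices)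
  ultimately show ?thesis by linarith
qed

theorem theorem3:
  fixes n :: nat
  assumes "n \<ge> 1"
  shows "sat_Q2 n < 10 * 2 ^ n"
proof (cases "n < 6")
  \<comment> \<open>For small \<open>n\<close> the whole cube has few enough edges; from 6 on,
    \<open>n + 2\<close> is at least 8, which allows \<open>r\<close> to be at least 2.\<close>
  case True
  then have "n * 2 ^ n < 20 * 2 ^ n" by simp
  then show ?thesis using sat_Q2_le_cube[of n] by linarith
next
  case False
  then obtain k where k: "2 ^ k \<le> n + 2" "n + 2 < 2 ^ (k + 1)"
    using ex_power_ivl1[of 2 "n + 2"] by auto
  have "3 \<le> k"
  proof (rule ccontr)
    assume "\<not> 3 \<le> k"
    then have "(2::nat) ^ (k + 1) \<le> 2 ^ 3" by (intro power_increasing) auto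
    then show False using k False by simp
  qed
  then obtain r where r: "k = r + 1" "2 \<le> r"
    using that[of "k - 1"] by simp
  define q :: nat where "q = 2 ^ r"
  have q: "2 * q \<le> n + 2" "n + 2 < 4 * q" using k r by (simp_all add: q_def)
  obtain p where p: "q = p + 1"
    by (metis q_def Suc_eq_plus1 not0_implies_Suc power_not_zero zero_neq_numeral)
  \<comment> \<open>Two blocks of size parameter \<open>q\<close> suffice while fewer than
    \<open>q\<close> coordinates are left with label 0. Beyond that the second block is doubled,
    again leaving fewer than \<open>q\<close>.\<close>
  show ?thesis
  proof (cases "n + 2 < 3 * q")
    case True
    define K :: nat where "K = 2 ^ (n - r)"
    define w where "w = n + 2 - (q + q)"
    have bound: "4 * sat_Q2 n \<le> (q - 1) * (12 * K + 3 * K) + (q - 1) * (12 * K + 3 * K)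
        + w * (6 * K + 3 * K)" and qK: "q * K = 2 ^ n"
      using sat_Q2_code_bound[of r r n] r q by (simp_all add: q_def K_def w_def)
    have "30 * p + 9 * w < 40 * q" using True p by (simp add: w_def)
    then have "(30 * p + 9 * w) * K < (40 * q) * K"
      by (rule mult_strict_right_mono) (simp add: K_def)
    then have "4 * sat_Q2 n < 40 * (q * K)"
      using bound p by (simp add: algebra_simps)
    then show ?thesis using qK by simp
  next
    case False
    define K :: nat where "K = 2 ^ (n - r)"
    define K' :: nat where "K' = 2 ^ (n - (r + 1))"
    define w where "w = n + 2 - (q + 2 * q)"
    have bound: "4 * sat_Q2 n \<le> (q - 1) * (12 * K + 3 * K') + (2 * q - 1) * (12 * K' + 3 * K)
        + w * (6 * K' + 3 * K)" and qK: "q * K = 2 ^ n" "2 * q * K' = 2 ^ n"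
      using sat_Q2_code_bound[of r "r + 1" n] r q False by (simp_all add: q_def K_def K'_def w_def)
    have "q * K = q * (2 * K')" using qK by simp
    then have K: "K = 2 * K'" using p unfolding mult_cancel1 by simp
    \<comment> \<open>With \<open>K = 2 * K'\<close>, the bound in units of \<open>K'\<close> is
      \<open>27 * p\<close> plus \<open>18 * (2 * p + 1)\<close> plus \<open>12 * w\<close>; the
      target is \<open>80 * q\<close>.\<close>
    have "63 * p + 18 + 12 * w < 80 * q" using q p by (simp add: w_def)
    then have "(63 * p + 18 + 12 * w) * K' < (80 * q) * K'"
      by (rule mult_strict_right_mono) (simp add: K'_def)
    then have "4 * sat_Q2 n < 40 * (2 * q * K')"
      using bound p K by (simp add: algebra_simps)
    then show ?thesis using qK by simp
  qed
qed

end
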